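(* Let $\hat a_x,\hat a_z\in\mathcal{F}$ with $x\neq z$. Then $$K(\hat a_z,\hat a_x)=\frac14\Big[\sum_{y}\Big(\int\hat a_x\hat a_z\hat a_y\,d\mu\Big)^2-\sum_{y}\int\hat a_z^2\hat a_y\,d\mu\int\hat a_x^2\hat a_y\,d\mu\Big],\qquad(1)$$ where $y$ ranges over all words indexing $\mathcal{F}$. If the length of $x$ is strictly larger than the length of $z$, then (1) equals $$\frac14\Big[\Big(\int\hat a_x^2\hat a_z\,d\mu\Big)^2-\sum_{y\in D[x,z]}\int\hat a_x^2\hat a_y\,d\mu\int\hat a_z^2\hat a_y\,d\mu\Big],$$ which is a sum of finitely many terms. In general, $\int\hat a_x^2\hat a_z\,d\mu=0$ if $z$ is not a subprefix of $x$. If $z$ is a strict subprefix of $x$ and $y$ is a strict subprefix of $z$, then $-\int\hat a_x^2\hat a_y\,d\mu\int\hat a_z^2\hat a_y\,d\mu\le 0$; moreover, $\int\hat a_z^2\hat a_x\,d\mu=0$. Consequently, for any given $x\ne z$, (1) is a sum of finitely many (nonzero) terms.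
   Context: Let $r,s\in(0,1)$, $P=\begin{pmatrix}P_{0,0}&P_{0,1}\\P_{1,0}&P_{1,1}\end{pmatrix}=\begin{pmatrix}r&1-r\\1-s&s\end{pmatrix}$, and let $\pi=(\pi_0,\pi_1)$ be the probability vector with $\pi P=\pi$. On $\{0,1\}^{\mathbb N}$ let $\mu$ be the Markov probability $\mu[x_1,\dots,x_n]=\pi_{x_1}P_{x_1,x_2}\cdots P_{x_{n-1},x_n}$. The Ruelle operator is $\mathscr{L}_{\log J}\varphi(x_1,x_2,\dots)=\sum_{i=0,1}\frac{\pi_iP_{i,x_1}}{\pi_{x_1}}\varphi(i,x_1,x_2,\dots)$. For a finite word $x=(x_1,\dots,x_n)$, $n\ge1$, $[x]$ is its cylinder and $$e_{[x]}=\tfrac{1}{\sqrt{\mu([x])}}\Big(\sqrt{\tfrac{P_{x_n,1}}{P_{x_n,0}}}\,1_{[x0]}-\sqrt{\tfrac{P_{x_n,0}}{P_{x_n,1}}}\,1_{[x1]}\Big),\quad a_x=\sqrt{\tfrac{\pi_{x_1}}{\pi_0P_{0,x_1}}}\,e_{[0x]}-\sqrt{\tfrac{\pi_{x_1}}{\pi_1P_{1,x_1}}}\,e_{[1x]},\quad \hat a_x=\frac{a_x}{|a_x|},$$ with $|\cdot|$ the $L^2(\mu)$ norm. Also $V_1=\pi_1P_{1,0}1_{[00]}-\pi_0P_{0,0}1_{[10]}$, $V_2=\pi_0P_{0,1}1_{[11]}-\pi_1P_{1,1}1_{[01]}$, $\hat a_\emptyset^0=V_1/|V_1|$, $\hat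 a_\emptyset^1=V_2/|V_2|$. $\mathcal{F}$ is the family of all $\hat a_x$ ($x$ a finite word of length $\ge1$) together with $\hat a_\emptyset^0,\hat a_\emptyset^1$ (attached to two versions $\emptyset^0,\emptyset^1$ of the empty word, of length $0$); a generic element of $\mathcal{F}$ is written $\hat a_x$. $\mathcal{F}$ is an orthonormal basis of the kernel of $\mathscr{L}_{\log J}$. $z$ is a subprefix of $x$ if $z=(x_1,\dots,x_k)$, $x=(x_1,\dots,x_n)$, $n\ge k\geq 1$; strict if $n>k$. By convention $\emptyset^i$ is a subprefix of itself and a strict subprefix of exactly the words of length $\ge1$ with first letter $i$. $D[x,z]$ is the set of all words (including $\emptyset^0,\emptyset^1$) that are subprefixes of both $x$ and $z$. $K$ denotes the sectional curvature, at $\mu$, of the Riemannian manifold $\mathcal{N}$ of Hölder equilibrium probabilities on $\{0,1\}^{\mathbb N}$ (tangent space at $\mu$: kernel of $\mathscr{L}_{\log J}$; metric $\langle X,Y\rangle=\int XY\,d\mu$). For distinct $X,Y\in\mathcal F$ it is expressed through the orthonormal basis $\mathcal F$ by $K(X,Y)=\frac14\big[\sum_{Z\in\mathcal F}(\int XYZ\,d\mu)^2-\sum_{Z\in\mathcal F}\int X^2Z\,d\mu\int Y^2Z\,d\mu\big]$, and this expression is what is meant by $K$ here. *)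

theory Defs
  imports "HOL-Probability.Probability" "HOL-Library.Z2" "HOL-Library.Sublist"
begin

text \<open>
  The alphabet is \<^typ>\<open>bit\<close>, whose elements are \<open>0\<close> and \<open>1\<close>. The coordinate \<open>x\<^sub>n\<close> of
  a sequence is \<open>\<omega> (n - 1)\<close>. Words are lists of letters.
\<close>

definition trans_mat :: "real \<Rightarrow> real \<Rightarrow> bit \<Rightarrow> bit \<Rightarrow> real" where
  "trans_mat r s i j =
     (if i = 0 then (if j = 0 then r else 1 - r) else (if j = 0 then 1 - s else s))"

definition stationary_vector :: "(bit \<Rightarrow> bit \<Rightarrow> real) \<Rightarrow> (bit \<Rightarrow> real) \<Rightarrow> bool" where
  "stationary_vector P p \<longleftrightarrow>
     (\<forall>i. 0 \<le> p i) \<and> p 0 + p 1 = 1 \<and> (\<forall>j. p 0 * P 0 j + p 1 * P 1 j = p j)"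

definition cylinder :: "bit list \<Rightarrow> (nat \<Rightarrow> bit) set" where
  "cylinder w = {\<omega>. \<forall>i<length w. \<omega> i = w ! i}"

definition markov_probability ::
    "(bit \<Rightarrow> bit \<Rightarrow> real) \<Rightarrow> (bit \<Rightarrow> real) \<Rightarrow> (nat \<Rightarrow> bit) measure \<Rightarrow> bool" where
  "markov_probability P p M \<longleftrightarrow>
     prob_space M \<and>
     sets M = sets (PiM UNIV (\<lambda>_. count_space UNIV)) \<and>
     (\<forall>w. w \<noteq> [] \<longrightarrow>
        measure M (cylinder w) = p (hd w) * (\<Prod>i<length w - 1. P (w ! i) (w ! Suc i)))"

text \<open>
  The index set of the family \<open>\<F>\<close>: \<open>Emp i\<close> is the version \<open>\<emptyset>\<^sup>i\<close> of the empty word, and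
  \<open>Word c w\<close> is the word \<open>c # w\<close> of length at least one.
\<close>

datatype word = Emp bit | Word bit "bit list"

primrec letters :: "word \<Rightarrow> bit list" where
  "letters (Emp i) = []"
| "letters (Word c w) = c # w"

definition word_length :: "word \<Rightarrow> nat" where
  "word_length x = length (letters x)"

fun subprefix :: "word \<Rightarrow> word \<Rightarrow> bool" where
  "subprefix (Word c v) (Word d w) \<longleftrightarrow> prefix (c # v) (d # w)"
| "subprefix (Emp i) (Word d w) \<longleftrightarrow> i = d"
| "subprefix (Emp i) (Emp j) \<longleftrightarrow> i = j"
| "subprefix (Word c v) (Emp j) \<longleftrightarrow> False"

definition strict_subprefix :: "word \<Rightarrow> word \<Rightarrow> bool" where
  "strict_subprefix z x \<longleftrightarrow> subprefix z x \<and> word_length z < word_length x"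

definition common_subprefixes :: "word \<Rightarrow> word \<Rightarrow> word set" where
  "common_subprefixes x z = {y. subprefix y x \<and> subprefix y z}"

definition l2_norm :: "'a measure \<Rightarrow> ('a \<Rightarrow> real) \<Rightarrow> real" where
  "l2_norm M f = sqrt (\<integral>\<omega>. (f \<omega>)\<^sup>2 \<partial>M)"

definition e_fun ::
    "(bit \<Rightarrow> bit \<Rightarrow> real) \<Rightarrow> (nat \<Rightarrow> bit) measure \<Rightarrow> bit list \<Rightarrow> (nat \<Rightarrow> bit) \<Rightarrow> real" where
  "e_fun P M w \<omega> =
     1 / sqrt (measure M (cylinder w)) *
     (sqrt (P (last w) 1 / P (last w) 0) * indicator (cylinder (w @ [0])) \<omega>
    - sqrt (P (last w) 0 / P (last w) 1) * indicator (cylinder (w @ [1])) \<omega>)"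

text \<open>On \<open>Emp 0\<close> and \<open>Emp 1\<close> the following gives \<open>V\<^sub>1\<close> and \<open>V\<^sub>2\<close>.\<close>

primrec a_fun ::
    "(bit \<Rightarrow> bit \<Rightarrow> real) \<Rightarrow> (bit \<Rightarrow> real) \<Rightarrow> (nat \<Rightarrow> bit) measure \<Rightarrow> word \<Rightarrow> (nat \<Rightarrow> bit) \<Rightarrow> real"
  where
  "a_fun P p M (Emp i) =
     (if i = 0
      then (\<lambda>\<omega>. p 1 * P 1 0 * indicator (cylinder [0, 0]) \<omega>
              - p 0 * P 0 0 * indicator (cylinder [1, 0]) \<omega>)
      else (\<lambda>\<omega>. p 0 * P 0 1 * indicator (cylinder [1, 1]) \<omega>
              - p 1 * P 1 1 * indicator (cylinder [0, 1]) \<omega>))"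
| "a_fun P p M (Word c w) =
     (\<lambda>\<omega>. sqrt (p c / (p 0 * P 0 c)) * e_fun P M (0 # c # w) \<omega>
         - sqrt (p c / (p 1 * P 1 c)) * e_fun P M (1 # c # w) \<omega>)"

definition a_hat ::
    "(bit \<Rightarrow> bit \<Rightarrow> real) \<Rightarrow> (bit \<Rightarrow> real) \<Rightarrow> (nat \<Rightarrow> bit) measure \<Rightarrow> word \<Rightarrow> (nat \<Rightarrow> bit) \<Rightarrow> real"
  where
  "a_hat P p M x = (\<lambda>\<omega>. a_fun P p M x \<omega> / l2_norm M (a_fun P p M x))"

definition kernel_basis ::
    "(bit \<Rightarrow> bit \<Rightarrow> real) \<Rightarrow> (bit \<Rightarrow> real) \<Rightarrow> (nat \<Rightarrow> bit) measure \<Rightarrow> ((nat \<Rightarrow> bit) \<Rightarrow> real) set"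
  where
  "kernel_basis P p M = range (a_hat P p M)"

abbreviation int_prod ::
    "'a measure \<Rightarrow> ('a \<Rightarrow> real) \<Rightarrow> ('a \<Rightarrow> real) \<Rightarrow> ('a \<Rightarrow> real) \<Rightarrow> real" where
  "int_prod M X Y Z \<equiv> (\<integral>\<omega>. X \<omega> * Y \<omega> * Z \<omega> \<partial>M)"

abbreviation int_sq :: "'a measure \<Rightarrow> ('a \<Rightarrow> real) \<Rightarrow> ('a \<Rightarrow> real) \<Rightarrow> real" where
  "int_sq M X Z \<equiv> (\<integral>\<omega>. (X \<omega>)\<^sup>2 * Z \<omega> \<partial>M)"

text \<open>
  The sectional curvature of the plane spanned by two distinct elements \<open>X\<close>, \<open>Y\<close> of the
  orthonormal basis \<open>\<F>\<close> of the tangent space at \<open>M\<close>, given by its expression in that basis.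
\<close>

definition sectional_curvature ::
    "(bit \<Rightarrow> bit \<Rightarrow> real) \<Rightarrow> (bit \<Rightarrow> real) \<Rightarrow> (nat \<Rightarrow> bit) measure \<Rightarrow>
     ((nat \<Rightarrow> bit) \<Rightarrow> real) \<Rightarrow> ((nat \<Rightarrow> bit) \<Rightarrow> real) \<Rightarrow> real" where
  "sectional_curvature P p M X Y =
     1 / 4 * ((\<Sum>\<^sub>\<infinity>Z\<in>kernel_basis P p M. (int_prod M X Y Z)\<^sup>2)
            - (\<Sum>\<^sub>\<infinity>Z\<in>kernel_basis P p M. int_sq M X Z * int_sq M Y Z))"

end

theory Submission
  imports Defs
begin

text \<open>
  Write \<open>q i c = p i * P i c / p c\<close> for the probability of \<open>\<omega> 0 = i\<close> given \<open>\<omega> 1 = c\<close>. Every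
  element of \<open>\<F>\<close> factors as \<open>G \<omega> * h x (\<omega> \<circ> Suc)\<close>, where \<open>G\<close> is a signed version of \<open>1 / q\<close> and
  depends only on the first two letters, while the functions \<open>h x\<close> form a Haar-like system: \<open>h x\<close>
  lives on the cylinder of \<open>x\<close> and, on it, depends only on the next letter. For the word \<open>\<emptyset>\<^sup>i\<close>
  the function \<open>h\<close> is a multiple of the indicator of \<open>[i]\<close>. By the Markov property the integral of
  \<open>G ^ n\<close> against a function of \<open>\<omega> \<circ> Suc\<close> living on \<open>[c]\<close> is a constant depending on \<open>n\<close> and \<open>c\<close>
  times the integral of that function, so \<open>h x\<close> has mean zero against every \<open>G ^ n\<close> when \<open>x\<close> is
  a nonempty word. Moreover \<open>h z\<close> is constant on the support of \<open>h x\<close> whenever \<open>x\<close> is not a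
  subprefix of \<open>z\<close>. All the assertions follow from these two facts.
\<close>

section \<open>Cylinders of finite words\<close>

lemma bit_cases: "(i::bit) = 0 \<or> i = 1"
  by (cases i) auto

lemma cylinder_Cons: "\<omega> \<in> cylinder (i # u) \<longleftrightarrow> \<omega> 0 = i \<and> \<omega> \<circ> Suc \<in> cylinder u"
  by (auto simp: cylinder_def less_Suc_eq_0_disj)

lemma cylinder_snoc: "\<omega> \<in> cylinder (u @ [j]) \<longleftrightarrow> \<omega> \<in> cylinder u \<and> \<omega> (length u) = j"
  by (auto simp: cylinder_def nth_append less_Suc_eq)

lemma cylinder_iff_prefix: "\<omega> \<in> cylinder u \<longleftrightarrow> map \<omega> [0..<length u] = u"
  by (simp add: cylinder_def list_eq_iff_nth_eq[of _ u])

lemma cylinder_antimono: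
  assumes "prefix u v"
  shows "cylinder v \<subseteq> cylinder u"
  using assms by (auto simp: cylinder_def prefix_def nth_append)

text \<open>A common point would make both words initial segments of one sequence, and the shorter
  of two such segments is a prefix of the longer.\<close>

lemma cylinder_disjoint:
  assumes "\<not> prefix u v" "\<not> prefix v u"
  shows "cylinder u \<inter> cylinder v = {}"
proof (rule ccontr)
  assume "cylinder u \<inter> cylinder v \<noteq> {}"
  then obtain \<omega> where "\<omega> \<in> cylinder u" "\<omega> \<in> cylinder v" by blast
  have "prefix (map \<omega> [0..<m]) (map \<omega> [0..<n])" if "m \<le> n" for m n
  proof -
    have "[0..<n] = [0..<m] @ [m..<n]"
      using upt_add_eq_append[of 0 m "n - m"] that by simp
    then show ?thesis by simp
  qed
  from this[of "length u" "length v"] this[of "length v" "length u"]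
  have "prefix u v \<or> prefix v u"
    using \<open>\<omega> \<in> cylinder u\<close> \<open>\<omega> \<in> cylinder v\<close> linear[of "length u" "length v"]
    by (auto simp: cylinder_iff_prefix)
  with assms show False by blast
qed

lemma sets_cylinder: "cylinder u \<in> sets (PiM UNIV (\<lambda>_. count_space UNIV))"
proof -
  define N :: "(nat \<Rightarrow> bit) measure" where "N = PiM UNIV (\<lambda>_. count_space UNIV)"
  have coord: "(\<lambda>\<omega>. \<omega> i) -` {u ! i} \<inter> space N \<in> sets N" for i
    unfolding N_def by (rule measurable_sets[OF measurable_component_singleton]) auto
  have "space N \<inter> (\<Inter>i\<in>{..<length u}. (\<lambda>\<omega>. \<omega> i) -` {u ! i} \<inter> space N) \<in> sets N"
  \<comment> \<open>\<open>sets.finite_INT\<close> needs a nonempty index set; for the empty word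
    the set is the whole space.\<close>
  proof (cases "u = []")
    case False
    then show ?thesis by (intro sets.Int sets.top sets.finite_INT coord) auto
  qed simp
  also have "space N \<inter> (\<Inter>i\<in>{..<length u}. (\<lambda>\<omega>. \<omega> i) -` {u ! i} \<inter> space N) = cylinder u"
    by (auto simp: N_def cylinder_def space_PiM PiE_UNIV_domain)
  finally show ?thesis unfolding N_def .
qed

section \<open>Words and the subprefix order\<close>

primrec stem :: "word \<Rightarrow> bit list" where
  "stem (Emp i) = [i]"
| "stem (Word c w) = c # w"

lemma stem_not_Nil [simp]: "stem x \<noteq> []"
  by (cases x) auto

lemma subprefix_refl [simp]: "subprefix x x"
  by (cases x) auto

lemma subprefix_imp_prefix_stem: "subprefix z x \<Longrightarrow> prefix (stem z) (stem x)"
  by (cases z; cases x) auto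

text \<open>Only comparability can be concluded, because \<open>Emp i\<close> and
  \<open>Word i []\<close> share the stem \<open>[i]\<close>: the stem of the latter is a prefix of
  that of the former, but the subprefix relation runs the other way.\<close>

lemma prefix_stem_imp_comparable: "prefix (stem z) (stem x) \<Longrightarrow> subprefix z x \<or> subprefix x z"
  by (cases z; cases x) auto

lemma subprefix_word_length: "subprefix z x \<Longrightarrow> word_length z \<le> word_length x"
  by (cases z; cases x) (auto simp: word_length_def dest: prefix_length_le)

lemma subprefix_antisym: "subprefix z x \<Longrightarrow> subprefix x z \<Longrightarrow> z = x"
  by (cases z; cases x) (auto simp: prefix_order.eq_iff)

lemma finite_subprefixes: "finite {y. subprefix y x}"
proof (rule finite_subset)
  show "{y. subprefix y x} \<subseteq> range Emp \<union> (\<lambda>u. Word (hd u) (tl u)) ` {u. prefix u (stem x)}"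
  proof
    fix y assume "y \<in> {y. subprefix y x}"
    then show "y \<in> range Emp \<union> (\<lambda>u. Word (hd u) (tl u)) ` {u. prefix u (stem x)}"
      by (cases y) (force dest: subprefix_imp_prefix_stem)+
  qed
  have "UNIV = {0, 1 :: bit}" using bit_cases by blast
  then have "finite (UNIV :: bit set)" by (metis finite.emptyI finite.insertI)
  moreover have "finite {u. prefix u (stem x)}"
    by (metis List.finite_set set_prefixes_eq)
  ultimately show "finite (range Emp \<union> (\<lambda>u. Word (hd u) (tl u)) ` {u. prefix u (stem x)})"
    by blast
qed

lemma finite_common_subprefixes: "finite (common_subprefixes x z)"
  unfolding common_subprefixes_def
  by (rule finite_subset[OF _ finite_subprefixes[of x]]) auto

section \<open>Infinite sums with finite support\<close>

lemma infsum_finite_support: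
  fixes f :: "'a \<Rightarrow> real"
  assumes "finite A" "\<And>y. y \<notin> A \<Longrightarrow> f y = 0"
  shows "(\<Sum>\<^sub>\<infinity>y. f y) = sum f A"
proof -
  have "(\<Sum>\<^sub>\<infinity>y. f y) = infsum f A"
    by (rule infsum_cong_neutral) (auto simp: assms)
  then show ?thesis using assms(1) by simp
qed

lemma infsum_single_support:
  fixes f :: "'a \<Rightarrow> real"
  assumes "\<And>y. y \<noteq> x \<Longrightarrow> f y = 0"
  shows "(\<Sum>\<^sub>\<infinity>y. f y) = f x"
proof -
  have "(\<Sum>\<^sub>\<infinity>y. f y) = sum f {x}"
    by (rule infsum_finite_support) (use assms in blast)+
  also have "\<dots> = f x" by simp
  finally show ?thesis .
qed

section \<open>The chain and the two factors of the basis functions\<close>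

locale two_state_chain =
  fixes P :: "bit \<Rightarrow> bit \<Rightarrow> real" and p :: "bit \<Rightarrow> real" and M :: "(nat \<Rightarrow> bit) measure"
  assumes P_pos: "\<And>i j. 0 < P i j"
    and p_pos: "\<And>i. 0 < p i"
    and markov: "markov_probability P p M"
begin

sublocale prob_space M
  using markov by (simp add: markov_probability_def)

abbreviation a_hat' where "a_hat' \<equiv> a_hat P p M"

definition q :: "bit \<Rightarrow> bit \<Rightarrow> real" where
  "q i c = p i * P i c / p c"

definition g :: "bit \<Rightarrow> bit \<Rightarrow> real" where
  "g i c = (if i = 0 then 1 else - 1) / q i c"

abbreviation G :: "(nat \<Rightarrow> bit) \<Rightarrow> real" where
  "G \<omega> \<equiv> g (\<omega> 0) (\<omega> (Suc 0))"

text \<open>For a stationary chain this is the \<open>n\<close>-th moment of \<open>G\<close>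
  conditional on \<open>\<omega> 1 = c\<close>.\<close>

definition g_moment :: "nat \<Rightarrow> bit \<Rightarrow> real" where
  "g_moment n c = q 0 c * g 0 c ^ n + q 1 c * g 1 c ^ n"

text \<open>The constant that turns \<open>G\<close> into \<open>V_1\<close> or \<open>V_2\<close>.
  The sign depends on \<open>i\<close> because \<open>V_2\<close> is positive on
  \<open>[11]\<close>, where \<open>G\<close> is negative.\<close>

definition emp_amp :: "bit \<Rightarrow> real" where
  "emp_amp i = (if i = 0 then 1 else - 1) * (p 0 * P 0 i * (p 1 * P 1 i) / p i)"

text \<open>The value of the unnormalized \<open>h x\<close> on the cylinder of
  \<open>stem x\<close> when the next letter is \<open>j\<close>. For \<open>Word c w\<close> the
  resulting function is \<open>e_fun P M (c # w)\<close>; for the empty words it does not vary with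
  the next letter.\<close>

primrec amp :: "word \<Rightarrow> bit \<Rightarrow> real" where
  "amp (Emp i) j = emp_amp i"
| "amp (Word c w) j = 1 / sqrt (measure M (cylinder (c # w))) *
     (if j = 0 then sqrt (P (last (c # w)) 1 / P (last (c # w)) 0)
      else - sqrt (P (last (c # w)) 0 / P (last (c # w)) 1))"

definition h :: "word \<Rightarrow> (nat \<Rightarrow> bit) \<Rightarrow> real" where
  "h x \<eta> = indicator (cylinder (stem x)) \<eta> * amp x (\<eta> (length (stem x)))
           / l2_norm M (a_fun P p M x)"

lemma q_pos: "0 < q i c"
  by (simp add: q_def P_pos p_pos)

lemma p_neq [simp]: "p i \<noteq> 0" and P_neq [simp]: "P i j \<noteq> 0" and q_neq [simp]: "q i c \<noteq> 0"
  using p_pos P_pos q_pos by (metis less_irrefl)+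

section \<open>Cylinder measures and integrals against powers of \<open>G\<close>\<close>

lemma cylinder_in_sets [measurable]: "cylinder u \<in> sets M"
  using markov sets_cylinder by (simp add: markov_probability_def)

lemma measure_cylinder:
  "u \<noteq> [] \<Longrightarrow>
     measure M (cylinder u) = p (hd u) * (\<Prod>i<length u - 1. P (u ! i) (u ! Suc i))"
  using markov by (simp add: markov_probability_def)

lemma measure_cylinder_pos: "u \<noteq> [] \<Longrightarrow> 0 < measure M (cylinder u)"
  by (simp add: measure_cylinder P_pos p_pos prod_pos)

text \<open>The Markov property read backwards: a letter put in front of a word starting with
  \<open>c\<close> replaces the factor \<open>p c\<close> by \<open>p i * P i c\<close>, whatever
  follows.\<close>

lemma measure_cylinder_Cons:
  assumes "u \<noteq> []"
  shows "measure M (cylinder (i # u)) = q i (hd u) * measure M (cylinder u)"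
proof -
  obtain c v where u: "u = c # v" using assms by (cases u) auto
  show ?thesis
    by (simp add: u measure_cylinder q_def prod.lessThan_Suc_shift del: prod.lessThan_Suc)
qed

lemma measure_cylinder_snoc:
  assumes "u \<noteq> []"
  shows "measure M (cylinder (u @ [j])) = measure M (cylinder u) * P (last u) j"
proof -
  obtain n where n: "length u = Suc n" using assms by (cases u) auto
  have "(\<Prod>i<n. P ((u @ [j]) ! i) ((u @ [j]) ! Suc i)) = (\<Prod>i<n. P (u ! i) (u ! Suc i))"
    by (rule prod.cong) (auto simp: nth_append n)
  moreover have "last u = u ! n" using assms n by (simp add: last_conv_nth)
  ultimately show ?thesis
    using assms n by (simp add: measure_cylinder nth_append)
qed

text \<open>Sorting by the first letter of \<open>\<omega>\<close> and the letter right after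
  \<open>u\<close> in \<open>\<omega> \<circ> Suc\<close> gives a combination of four cylinder
  indicators. Both the coefficients and the measures split into a part for the first letter and a
  part for the last, so the sum of four terms is a product.\<close>

lemma integral_G_power:
  assumes "u \<noteq> []"
  shows "(\<integral>\<omega>. G \<omega> ^ n * (indicator (cylinder u) (\<omega> \<circ> Suc) * f (\<omega> (Suc (length u)))) \<partial>M) =
    g_moment n (hd u) * (measure M (cylinder u) * (P (last u) 0 * f 0 + P (last u) 1 * f 1))"
proof -
  define m where "m i j = measure M (cylinder (i # u @ [j]))" for i j
  have m: "m i j = q i (hd u) * measure M (cylinder u) * P (last u) j" for i j
    using assms by (simp add: m_def measure_cylinder_Cons measure_cylinder_snoc)
  define k where "k i j = g i (hd u) ^ n * f j" for i j
  have pw: "G \<omega> ^ n * (indicator (cylinder u) (\<omega> \<circ> Suc) * f (\<omega> (Suc (length u)))) =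
      k 0 0 * indicator (cylinder (0 # u @ [0])) \<omega> + k 0 1 * indicator (cylinder (0 # u @ [1])) \<omega> +
      (k 1 0 * indicator (cylinder (1 # u @ [0])) \<omega> + k 1 1 * indicator (cylinder (1 # u @ [1])) \<omega>)"
    for \<omega>
  proof (cases "\<omega> \<circ> Suc \<in> cylinder u")
    case True
    \<comment> \<open>Hence \<open>G \<omega>\<close> equals \<open>g (\<omega> 0) (hd u)\<close>,
      which takes only two values here.\<close>
    then have "\<omega> (Suc 0) = hd u"
      using assms by (cases u) (auto simp: cylinder_Cons)
    with True bit_cases[of "\<omega> 0"] bit_cases[of "\<omega> (Suc (length u))"] show ?thesis
      by (auto simp: indicator_def cylinder_Cons cylinder_snoc k_def)
  next
    case False
    then show ?thesis by (simp add: indicator_def cylinder_Cons cylinder_snoc)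
  qed
  have int: "has_bochner_integral M (\<lambda>\<omega>. k i j * indicator (cylinder (i # u @ [j])) \<omega>) (k i j * m i j)"
    for i j
    unfolding m_def
    by (intro has_bochner_integral_mult_right has_bochner_integral_real_indicator)
      (auto simp: less_top[symmetric])
  have "(\<integral>\<omega>. G \<omega> ^ n * (indicator (cylinder u) (\<omega> \<circ> Suc) * f (\<omega> (Suc (length u)))) \<partial>M) =
      k 0 0 * m 0 0 + k 0 1 * m 0 1 + (k 1 0 * m 1 0 + k 1 1 * m 1 1)"
    unfolding pw by (intro has_bochner_integral_integral_eq has_bochner_integral_add int)
  also have "\<dots> = g_moment n (hd u) *
      (measure M (cylinder u) * (P (last u) 0 * f 0 + P (last u) 1 * f 1))"
    by (simp add: m k_def g_moment_def algebra_simps)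
  finally show ?thesis .
qed

section \<open>Factorization, mean zero and normalization of the basis functions\<close>

lemma a_fun_eq:
  "a_fun P p M x \<omega> =
     G \<omega> * (indicator (cylinder (stem x)) (\<omega> \<circ> Suc) * amp x (\<omega> (Suc (length (stem x)))))"
proof (cases x)
  case (Emp i)
  show ?thesis
    using bit_cases[of i] bit_cases[of "\<omega> 0"] bit_cases[of "\<omega> (Suc 0)"] unfolding Emp
    by (auto simp: indicator_def cylinder_def less_Suc_eq_0_disj less_Suc_eq g_def q_def emp_amp_def
        field_simps)
next
  case (Word c w)
  \<comment> \<open>Each of the two square roots on the left contributes one factor
    \<open>1 / sqrt (q i c)\<close>; together they give the \<open>1 / q\<close> of
    \<open>G\<close>.\<close>
  have coeff: "sqrt (p c / (p i * P i c)) * (1 / sqrt (measure M (cylinder (i # c # w)))) =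
      1 / q i c * (1 / sqrt (measure M (cylinder (c # w))))" for i
  proof -
    have "p c / (p i * P i c) = 1 / q i c" by (simp add: q_def)
    then have "sqrt (p c / (p i * P i c)) = 1 / sqrt (q i c)" by (simp add: real_sqrt_divide)
    moreover have "measure M (cylinder (i # c # w)) = q i c * measure M (cylinder (c # w))"
      by (simp add: measure_cylinder_Cons)
    moreover have "sqrt (q i c) * sqrt (q i c) = q i c"
      using q_pos[of i c] by simp
    ultimately show ?thesis
      by (simp add: real_sqrt_mult)
  qed
  \<comment> \<open>The function \<open>e_fun P M (c # w)\<close> without its normalizing factor; it
    will be evaluated at the shifted sequence.\<close>
  define E where "E \<omega> = sqrt (P (last (c # w)) 1 / P (last (c # w)) 0) * indicator (cylinder (c # w @ [0])) \<omega>
    - sqrt (P (last (c # w)) 0 / P (last (c # w)) 1) * indicator (cylinder (c # w @ [1])) \<omega>"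
    for \<omega> :: "nat \<Rightarrow> bit"
  have e: "e_fun P M (i # c # w) \<omega> = 1 / sqrt (measure M (cylinder (i # c # w))) *
      (if \<omega> 0 = i then E (\<omega> \<circ> Suc) else 0)" for i
    by (simp add: e_fun_def E_def indicator_def cylinder_Cons[of _ i])
  have split: "sqrt (p c / (p i * P i c)) * e_fun P M (i # c # w) \<omega> =
      1 / q i c * (1 / sqrt (measure M (cylinder (c # w)))) * (if \<omega> 0 = i then E (\<omega> \<circ> Suc) else 0)" for i
    unfolding e coeff[symmetric] by (simp only: mult.assoc)
  have E: "1 / sqrt (measure M (cylinder (c # w))) * E (\<omega> \<circ> Suc) =
      indicator (cylinder (c # w)) (\<omega> \<circ> Suc) * amp x (\<omega> (Suc (length (c # w))))"
    using bit_cases[of "\<omega> (Suc (length (c # w)))"]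
    by (auto simp: E_def Word indicator_def cylinder_snoc[of _ "c # w", simplified])
  have "a_fun P p M x \<omega> = 1 / q 0 c * (1 / sqrt (measure M (cylinder (c # w)))) * (if \<omega> 0 = 0 then E (\<omega> \<circ> Suc) else 0)
    - 1 / q 1 c * (1 / sqrt (measure M (cylinder (c # w)))) * (if \<omega> 0 = 1 then E (\<omega> \<circ> Suc) else 0)"
    unfolding Word a_fun.simps split ..
  also have "\<dots> = (if \<omega> 0 = 0 then 1 else - 1) / q (\<omega> 0) c *
      (1 / sqrt (measure M (cylinder (c # w))) * E (\<omega> \<circ> Suc))"
    using bit_cases[of "\<omega> 0"] by auto
  \<comment> \<open>Off the cylinder both sides vanish; on it \<open>\<omega> (Suc 0) = c\<close>,
    so the prefactor is \<open>G \<omega>\<close>.\<close>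
  also have "\<dots> = G \<omega> * (indicator (cylinder (stem x)) (\<omega> \<circ> Suc) * amp x (\<omega> (Suc (length (stem x)))))"
    unfolding E by (auto simp: Word g_def indicator_def cylinder_Cons)
  finally show ?thesis .
qed

lemma a_hat_eq: "a_hat' x \<omega> = G \<omega> * h x (\<omega> \<circ> Suc)"
  by (simp add: a_hat_def h_def a_fun_eq)

text \<open>With \<open>i\<close> the last letter, both terms have the absolute value
  \<open>sqrt (P i 0 * P i 1)\<close> over the root of the cylinder measure, with opposite
  signs.\<close>

lemma amp_mean_zero:
  "P (last (c # w)) 0 * amp (Word c w) 0 + P (last (c # w)) 1 * amp (Word c w) 1 = 0"
proof -
  have "P i 0 * sqrt (P i 1 / P i 0) = P i 1 * sqrt (P i 0 / P i 1)" for i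
    using P_pos[of i 0] P_pos[of i 1]
    by (simp add: real_sqrt_divide field_simps)
  then show ?thesis by simp
qed

lemma amp_neq_0: "amp x j \<noteq> 0"
proof (cases x)
  case (Word c w)
  then show ?thesis using measure_cylinder_pos[of "c # w"] by simp
qed (simp add: emp_amp_def)

lemma g_moment_2_pos: "0 < g_moment 2 c"
  using q_pos by (simp add: g_moment_def g_def power2_eq_square add_pos_pos)

lemma l2_norm_a_fun_pos: "0 < l2_norm M (a_fun P p M x)"
proof -
  have "(\<integral>\<omega>. (a_fun P p M x \<omega>)\<^sup>2 \<partial>M) =
    (\<integral>\<omega>. G \<omega> ^ 2 * (indicator (cylinder (stem x)) (\<omega> \<circ> Suc) *
        (amp x (\<omega> (Suc (length (stem x)))))\<^sup>2) \<partial>M)"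
    unfolding a_fun_eq
    by (intro Bochner_Integration.integral_cong) (auto simp: indicator_def power_mult_distrib)
  also have "\<dots> > 0"
    unfolding integral_G_power[OF stem_not_Nil, where f = "\<lambda>j. (amp x j)\<^sup>2"]
    by (intro mult_pos_pos add_pos_pos g_moment_2_pos measure_cylinder_pos P_pos)
      (simp_all add: amp_neq_0)
  finally show ?thesis by (simp add: l2_norm_def)
qed

lemma integral_a_hat_sq: "(\<integral>\<omega>. (a_hat' x \<omega>)\<^sup>2 \<partial>M) = 1"
proof -
  have l2: "(l2_norm M (a_fun P p M x))\<^sup>2 = (\<integral>\<omega>. (a_fun P p M x \<omega>)\<^sup>2 \<partial>M)"
    by (simp add: l2_norm_def)
  show ?thesis
    using l2_norm_a_fun_pos[of x] by (simp add: a_hat_def power_divide l2[symmetric])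
qed

lemma integral_h_mean_zero: "(\<integral>\<omega>. G \<omega> ^ n * h (Word c w) (\<omega> \<circ> Suc) \<partial>M) = 0"
proof -
  have "(\<integral>\<omega>. G \<omega> ^ n * (indicator (cylinder (c # w)) (\<omega> \<circ> Suc) *
      amp (Word c w) (\<omega> (Suc (length (c # w))))) \<partial>M) = 0"
    unfolding integral_G_power[of "c # w" n "amp (Word c w)", OF list.distinct(2)]
    by (simp only: amp_mean_zero mult_zero_right)
  then show ?thesis
    by (simp add: h_def del: amp.simps)
qed

text \<open>The integrals against \<open>G ^ 2\<close> and \<open>G ^ 3\<close> share the factor
  \<open>c\<close>. The first is the squared norm of \<open>a_hat' x\<close>, which is 1, and this
  determines \<open>c\<close>. The outcome depends on \<open>x\<close> only through the first letter
  of its stem.\<close>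

lemma integral_h_sq:
  "(\<integral>\<omega>. G \<omega> ^ 3 * (h x (\<omega> \<circ> Suc))\<^sup>2 \<partial>M) = g_moment 3 (hd (stem x)) / g_moment 2 (hd (stem x))"
proof -
  define f where "f j = (amp x j / l2_norm M (a_fun P p M x))\<^sup>2" for j
  define c where "c = measure M (cylinder (stem x)) *
     (P (last (stem x)) 0 * f 0 + P (last (stem x)) 1 * f 1)"
  have h2: "(h x (\<omega> \<circ> Suc))\<^sup>2 = indicator (cylinder (stem x)) (\<omega> \<circ> Suc) * f (\<omega> (Suc (length (stem x))))"
    for \<omega>
    by (simp add: h_def f_def indicator_def power_mult_distrib)
  have "(\<integral>\<omega>. G \<omega> ^ n * (h x (\<omega> \<circ> Suc))\<^sup>2 \<partial>M) = g_moment n (hd (stem x)) * c" for n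
    unfolding h2 c_def by (rule integral_G_power) simp
  moreover from this[of 2] have "g_moment 2 (hd (stem x)) * c = 1"
    using integral_a_hat_sq[of x] by (simp add: a_hat_eq power_mult_distrib)
  ultimately show ?thesis
    using g_moment_2_pos[of "hd (stem x)"] by (simp add: field_simps)
qed

section \<open>Products of two Haar-like functions and orthogonality\<close>

lemma h_eq_0: "\<eta> \<notin> cylinder (stem x) \<Longrightarrow> h x \<eta> = 0"
  by (simp add: h_def)

text \<open>For nonempty \<open>z\<close> the stem of \<open>x\<close> also fixes the letter after
  \<open>z\<close>, which is all that \<open>h z\<close> can still see. For \<open>z = Emp i\<close>
  there is no dependence on the next letter, so equal stems do no harm.\<close>

lemma h_const_on:
  assumes "subprefix z x" "z \<noteq> x"
  obtains k where "\<And>\<eta>. \<eta> \<in> cylinder (stem x) \<Longrightarrow> h z \<eta> = k"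
proof (cases z)
  case (Emp i)
  show ?thesis
  proof
    fix \<eta> assume "\<eta> \<in> cylinder (stem x)"
    then have "\<eta> \<in> cylinder (stem z)"
      using cylinder_antimono[OF subprefix_imp_prefix_stem[OF assms(1)]] by blast
    then show "h z \<eta> = emp_amp i / l2_norm M (a_fun P p M z)"
      by (simp add: h_def Emp)
  qed
next
  case (Word c v)
  from Word assms obtain d w where x: "x = Word d w" by (cases x) auto
  from assms Word x have "strict_prefix (stem z) (stem x)" by (simp add: strict_prefix_def)
  then obtain j u where u: "stem x = stem z @ j # u" by (elim strict_prefixE')
  show ?thesis
  proof
    fix \<eta> assume "\<eta> \<in> cylinder (stem x)"
    moreover have "prefix (stem z @ [j]) (stem x)" by (simp add: u)
    ultimately have "\<eta> \<in> cylinder (stem z @ [j])" using cylinder_antimono by blast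
    then show "h z \<eta> = amp z j / l2_norm M (a_fun P p M z)"
      by (simp add: h_def cylinder_snoc)
  qed
qed

lemma h_mult_disjoint:
  assumes "\<not> subprefix z x" "\<not> subprefix x z"
  shows "h z \<eta> * h x \<eta> = 0"
proof -
  have "cylinder (stem z) \<inter> cylinder (stem x) = {}"
    using assms prefix_stem_imp_comparable by (intro cylinder_disjoint) blast+
  then show ?thesis using h_eq_0 by (metis disjoint_iff mult_eq_0_iff)
qed

text \<open>Either \<open>z\<close> is a proper subprefix of \<open>x\<close> and \<open>h z\<close>
  is constant where \<open>h x\<close> lives, or the supports are disjoint and \<open>k = 0\<close>.
  The second conclusion ensures that \<open>x\<close> is a nonempty word when \<open>k\<close> is
  nonzero, so that its mean vanishes.\<close>

lemma h_absorb:
  assumes "\<not> subprefix x z"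
  obtains k where "\<And>\<eta>. h z \<eta> * h x \<eta> = k * h x \<eta>" "k \<noteq> 0 \<Longrightarrow> subprefix z x"
proof (cases "subprefix z x")
  case True
  with assms obtain k where "\<And>\<eta>. \<eta> \<in> cylinder (stem x) \<Longrightarrow> h z \<eta> = k"
    by (metis h_const_on)
  with that[of k] True show ?thesis by (metis h_eq_0 mult_zero_right)
next
  case False
  with that[of 0] h_mult_disjoint assms show ?thesis by simp
qed

lemma not_subprefixE:
  assumes "\<not> subprefix x z" "subprefix z x"
  obtains c w where "x = Word c w"
  using assms by (cases x; cases z) auto

text \<open>Of two distinct words, at least one is not a subprefix of the other; its function
  absorbs the other one and has mean zero unless the absorbed constant is 0. The power
  \<open>n = 2\<close> is the orthogonality of the family, and \<open>n = 3\<close> serves the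
  triple integrals.\<close>

lemma h_orthogonal:
  assumes "x \<noteq> y"
  shows "(\<integral>\<omega>. G \<omega> ^ n * (h x (\<omega> \<circ> Suc) * h y (\<omega> \<circ> Suc)) \<partial>M) = 0"
proof -
  have *: "(\<integral>\<omega>. G \<omega> ^ n * (h z (\<omega> \<circ> Suc) * h x (\<omega> \<circ> Suc)) \<partial>M) = 0" if x: "\<not> subprefix x z" for x z
  proof -
    obtain k where k: "\<And>\<eta>. h z \<eta> * h x \<eta> = k * h x \<eta>" "k \<noteq> 0 \<Longrightarrow> subprefix z x"
      using h_absorb[OF x] by blast
    have "(\<integral>\<omega>. G \<omega> ^ n * (h z (\<omega> \<circ> Suc) * h x (\<omega> \<circ> Suc)) \<partial>M) =
        k * (\<integral>\<omega>. G \<omega> ^ n * h x (\<omega> \<circ> Suc) \<partial>M)"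
      by (simp add: k(1) mult.left_commute)
    also have "\<dots> = 0"
    proof (cases "k = 0")
      case False
      then obtain c w where "x = Word c w" using k(2) x not_subprefixE by blast
      then show ?thesis by (simp only: integral_h_mean_zero mult_zero_right)
    qed simp
    finally show ?thesis .
  qed
  show ?thesis
  proof (cases "subprefix y x")
    case False
    then show ?thesis by (rule *)
  next
    case True
    with assms have "\<not> subprefix x y" using subprefix_antisym by blast
    then have "(\<integral>\<omega>. G \<omega> ^ n * (h y (\<omega> \<circ> Suc) * h x (\<omega> \<circ> Suc)) \<partial>M) = 0" by (rule *)
    then show ?thesis by (simp only: mult.commute[of "h y _" "h x _"])
  qed
qed

text \<open>Lets the sums over the set of functions \<open>kernel_basis\<close> be reindexed by
  words. Two equal basis functions would be both orthogonal and of norm 1.\<close>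

lemma inj_a_hat: "inj a_hat'"
proof (rule injI, rule ccontr)
  fix x y assume eq: "a_hat' x = a_hat' y" and "x \<noteq> y"
  have "1 = (\<integral>\<omega>. a_hat' x \<omega> * a_hat' y \<omega> \<partial>M)"
    using integral_a_hat_sq[of x] by (simp add: eq power2_eq_square)
  also have "\<dots> = (\<integral>\<omega>. G \<omega> ^ 2 * (h x (\<omega> \<circ> Suc) * h y (\<omega> \<circ> Suc)) \<partial>M)"
    by (simp add: a_hat_eq power2_eq_square mult_ac)
  finally show False using h_orthogonal[OF \<open>x \<noteq> y\<close>] by simp
qed

section \<open>Triple integrals of basis functions\<close>

lemma int_prod_eq:
  "int_prod M (a_hat' x) (a_hat' z) (a_hat' y) =
     (\<integral>\<omega>. G \<omega> ^ 3 * (h z (\<omega> \<circ> Suc) * h x (\<omega> \<circ> Suc) * h y (\<omega> \<circ> Suc)) \<partial>M)"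
  by (simp add: a_hat_eq power3_eq_cube mult_ac)

lemma int_sq_eq_int_prod: "int_sq M (a_hat' x) (a_hat' z) = int_prod M (a_hat' x) (a_hat' z) (a_hat' x)"
  by (simp add: power2_eq_square mult_ac)

text \<open>\<open>h z\<close> is absorbed into \<open>h x\<close>, which leaves \<open>h x\<close>
  against \<open>h y\<close> with weight \<open>G ^ 3\<close>.\<close>

lemma int_prod_eq_0:
  assumes "\<not> subprefix x z" "y \<noteq> x"
  shows "int_prod M (a_hat' x) (a_hat' z) (a_hat' y) = 0"
proof -
  obtain k where k: "\<And>\<eta>. h z \<eta> * h x \<eta> = k * h x \<eta>"
    using h_absorb[OF assms(1)] by blast
  have "int_prod M (a_hat' x) (a_hat' z) (a_hat' y) =
      k * (\<integral>\<omega>. G \<omega> ^ 3 * (h x (\<omega> \<circ> Suc) * h y (\<omega> \<circ> Suc)) \<partial>M)"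
    unfolding int_prod_eq k by (simp add: mult.assoc mult.left_commute[of _ k])
  then show ?thesis using h_orthogonal assms(2) by simp
qed

lemma int_sq_eq_0:
  assumes "\<not> subprefix z x"
  shows "int_sq M (a_hat' x) (a_hat' z) = 0"
proof -
  \<comment> \<open>One copy of \<open>h x\<close> is absorbed into \<open>h z\<close>; the other
    copy is then orthogonal to \<open>h z\<close>.\<close>
  have "int_prod M (a_hat' z) (a_hat' x) (a_hat' x) = 0"
    using assms by (intro int_prod_eq_0) auto
  moreover have "int_sq M (a_hat' x) (a_hat' z) = int_prod M (a_hat' z) (a_hat' x) (a_hat' x)"
    by (intro Bochner_Integration.integral_cong) (auto simp: power2_eq_square)
  ultimately show ?thesis by (rule trans[rotated])
qed

text \<open>\<open>k\<close> is the value of \<open>h y\<close> on the cylinder of \<open>z\<close>,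
  and the remaining integral sees only the first letter. Since \<open>k\<close> is chosen before
  \<open>x\<close>, all extensions of \<open>z\<close> give the same integral.\<close>

lemma int_sq_strict_subprefix:
  assumes "strict_subprefix y z"
  obtains k where
    "\<And>x. subprefix z x \<Longrightarrow>
       int_sq M (a_hat' x) (a_hat' y) = k * (g_moment 3 (hd (stem z)) / g_moment 2 (hd (stem z)))"
proof -
  obtain k where k: "\<And>\<eta>. \<eta> \<in> cylinder (stem z) \<Longrightarrow> h y \<eta> = k"
    using assms by (metis h_const_on strict_subprefix_def less_irrefl)
  show ?thesis
  proof
    fix x assume x: "subprefix z x"
    then have pre: "prefix (stem z) (stem x)" by (rule subprefix_imp_prefix_stem)
    then have "hd (stem x) = hd (stem z)" by (auto simp: prefix_def)
    moreover have "h y \<eta> * h x \<eta> * h x \<eta> = k * (h x \<eta>)\<^sup>2" for \<eta>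
      using cylinder_antimono[OF pre] k h_eq_0[of \<eta> x]
      by (cases "\<eta> \<in> cylinder (stem x)") (auto simp: power2_eq_square)
    ultimately show "int_sq M (a_hat' x) (a_hat' y) = k * (g_moment 3 (hd (stem z)) / g_moment 2 (hd (stem z)))"
      unfolding int_sq_eq_int_prod int_prod_eq
      by (simp add: mult.left_commute[of _ k] integral_h_sq)
  qed
qed

text \<open>\<open>x\<close> and \<open>z\<close> both extend \<open>z\<close>, so the two factors
  coincide and the product is a square.\<close>

lemma int_sq_mult_nonneg:
  assumes "strict_subprefix z x" "strict_subprefix y z"
  shows "0 \<le> int_sq M (a_hat' x) (a_hat' y) * int_sq M (a_hat' z) (a_hat' y)"
proof -
  obtain k where k: "\<And>x. subprefix z x \<Longrightarrow>
      int_sq M (a_hat' x) (a_hat' y) = k * (g_moment 3 (hd (stem z)) / g_moment 2 (hd (stem z)))"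
    using int_sq_strict_subprefix[OF assms(2)] by blast
  have "subprefix z x" using assms(1) by (simp add: strict_subprefix_def)
  then show ?thesis unfolding k[OF \<open>subprefix z x\<close>] k[OF subprefix_refl] by simp
qed

section \<open>The curvature sums and their finiteness\<close>

lemma sectional_curvature_a_hat:
  "sectional_curvature P p M (a_hat' z) (a_hat' x) =
     1 / 4 * ((\<Sum>\<^sub>\<infinity>y. (int_prod M (a_hat' x) (a_hat' z) (a_hat' y))\<^sup>2)
            - (\<Sum>\<^sub>\<infinity>y. int_sq M (a_hat' z) (a_hat' y) * int_sq M (a_hat' x) (a_hat' y)))"
  unfolding sectional_curvature_def kernel_basis_def infsum_reindex[OF inj_a_hat] o_def
  by (simp add: mult.commute[of "a_hat' z _" "a_hat' x _"])

text \<open>By \<open>int_prod_eq_0\<close> only the term \<open>y = x\<close> survives.\<close>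

lemma infsum_int_prod_sq:
  assumes "\<not> subprefix x z"
  shows "(\<Sum>\<^sub>\<infinity>y. (int_prod M (a_hat' x) (a_hat' z) (a_hat' y))\<^sup>2) =
    (int_sq M (a_hat' x) (a_hat' z))\<^sup>2"
  unfolding int_sq_eq_int_prod
  by (rule infsum_single_support) (simp add: int_prod_eq_0[OF assms])

lemma infsum_int_sq_mult:
  "(\<Sum>\<^sub>\<infinity>y. int_sq M (a_hat' z) (a_hat' y) * int_sq M (a_hat' x) (a_hat' y)) =
   (\<Sum>y\<in>common_subprefixes x z. int_sq M (a_hat' x) (a_hat' y) * int_sq M (a_hat' z) (a_hat' y))"
proof -
  have "(\<Sum>\<^sub>\<infinity>y. int_sq M (a_hat' z) (a_hat' y) * int_sq M (a_hat' x) (a_hat' y)) =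
   (\<Sum>y\<in>common_subprefixes x z. int_sq M (a_hat' z) (a_hat' y) * int_sq M (a_hat' x) (a_hat' y))"
    by (rule infsum_finite_support[OF finite_common_subprefixes])
      (auto simp: common_subprefixes_def int_sq_eq_0)
  then show ?thesis by (simp only: mult.commute)
qed

text \<open>The triple integral is symmetric in \<open>x\<close> and \<open>z\<close>. Whichever of
  the two is not a subprefix of the other absorbs it and is the only possible
  \<open>y\<close>.\<close>

lemma finite_int_prod_neq_0:
  assumes "x \<noteq> z"
  shows "finite {y. (int_prod M (a_hat' x) (a_hat' z) (a_hat' y))\<^sup>2 \<noteq> 0}"
proof (rule finite_subset)
  have "int_prod M (a_hat' x) (a_hat' z) (a_hat' y) = int_prod M (a_hat' z) (a_hat' x) (a_hat' y)" for y
    by (simp add: mult_ac)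
  moreover have "\<not> subprefix x z \<or> \<not> subprefix z x"
    using assms subprefix_antisym by blast
  ultimately have "int_prod M (a_hat' x) (a_hat' z) (a_hat' y) = 0" if "y \<notin> {x, z}" for y
    using that int_prod_eq_0[of x z y] int_prod_eq_0[of z x y] by auto
  then show "{y. (int_prod M (a_hat' x) (a_hat' z) (a_hat' y))\<^sup>2 \<noteq> 0} \<subseteq> {x, z}"
    by force
qed simp

lemma finite_int_sq_mult_neq_0:
  "finite {y. int_sq M (a_hat' z) (a_hat' y) * int_sq M (a_hat' x) (a_hat' y) \<noteq> 0}"
proof (rule finite_subset[OF _ finite_subprefixes[of x]])
  show "{y. int_sq M (a_hat' z) (a_hat' y) * int_sq M (a_hat' x) (a_hat' y) \<noteq> 0} \<subseteq> {y. subprefix y x}"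
    using int_sq_eq_0 by (auto simp del: integral_mult_left_zero)
qed

end

section \<open>The given two-state chain and the assembly of the assertions\<close>

lemma two_state_chain_trans_mat:
  assumes "0 < r" "r < 1" "0 < s" "s < 1"
    and "stationary_vector (trans_mat r s) p"
    and "markov_probability (trans_mat r s) p M"
  shows "two_state_chain (trans_mat r s) p M"
proof
  have nn: "\<And>i. 0 \<le> p i" and sum: "p 0 + p 1 = 1"
    and st: "\<And>j. p 0 * trans_mat r s 0 j + p 1 * trans_mat r s 1 j = p j"
    using assms(5) by (auto simp: stationary_vector_def)
  show P_pos: "0 < trans_mat r s i j" for i j
    using assms by (simp add: trans_mat_def)
  show "0 < p j" for j
  proof -
    have "p 0 > 0 \<or> p 1 > 0" using sum by linarith
    \<comment> \<open>Some state has positive mass, and one step of the chain carries part of it to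
      every state.\<close>
    then have "0 < p 0 * trans_mat r s 0 j + p 1 * trans_mat r s 1 j"
      using nn P_pos by (metis add_nonneg_pos add_pos_nonneg less_imp_le mult_nonneg_nonneg mult_pos_pos)
    then show ?thesis by (simp add: st)
  qed
  show "markov_probability (trans_mat r s) p M" by fact
qed

theorem theorem7p7:
  fixes r s :: real
    and P :: "bit \<Rightarrow> bit \<Rightarrow> real"
    and p :: "bit \<Rightarrow> real"
    and M :: "(nat \<Rightarrow> bit) measure"
  assumes "0 < r" "r < 1" "0 < s" "s < 1"
    and "P = trans_mat r s"
    and "stationary_vector P p"
    and "markov_probability P p M"
  shows
    "(\<forall>x z. x \<noteq> z \<longrightarrow>
        sectional_curvature P p M (a_hat P p M z) (a_hat P p M x) =
          1 / 4 * ((\<Sum>\<^sub>\<infinity>y. (int_prod M (a_hat P p M x) (a_hat P p M z) (a_hat P p M y))\<^sup>2)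
                 - (\<Sum>\<^sub>\<infinity>y. int_sq M (a_hat P p M z) (a_hat P p M y)
                          * int_sq M (a_hat P p M x) (a_hat P p M y))))
     \<and> (\<forall>x z. word_length z < word_length x \<longrightarrow>
        finite (common_subprefixes x z) \<and>
        1 / 4 * ((\<Sum>\<^sub>\<infinity>y. (int_prod M (a_hat P p M x) (a_hat P p M z) (a_hat P p M y))\<^sup>2)
               - (\<Sum>\<^sub>\<infinity>y. int_sq M (a_hat P p M z) (a_hat P p M y)
                        * int_sq M (a_hat P p M x) (a_hat P p M y))) =
          1 / 4 * ((int_sq M (a_hat P p M x) (a_hat P p M z))\<^sup>2
                 - (\<Sum>y\<in>common_subprefixes x z.
                      int_sq M (a_hat P p M x) (a_hat P p M y)
                    * int_sq M (a_hat P p M z) (a_hat P p M y))))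
     \<and> (\<forall>x z. \<not> subprefix z x \<longrightarrow> int_sq M (a_hat P p M x) (a_hat P p M z) = 0)
     \<and> (\<forall>x z y. strict_subprefix z x \<and> strict_subprefix y z \<longrightarrow>
        - (int_sq M (a_hat P p M x) (a_hat P p M y)
         * int_sq M (a_hat P p M z) (a_hat P p M y)) \<le> 0)
     \<and> (\<forall>x z. strict_subprefix z x \<longrightarrow> int_sq M (a_hat P p M z) (a_hat P p M x) = 0)
     \<and> (\<forall>x z. x \<noteq> z \<longrightarrow>
        finite {y. (int_prod M (a_hat P p M x) (a_hat P p M z) (a_hat P p M y))\<^sup>2 \<noteq> 0} \<and>
        finite {y. int_sq M (a_hat P p M z) (a_hat P p M y)
                 * int_sq M (a_hat P p M x) (a_hat P p M y) \<noteq> 0})"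
proof -
  interpret two_state_chain P p M
    using assms two_state_chain_trans_mat by simp
  have long: "\<not> subprefix x z" if "word_length z < word_length x" for x z
    using that subprefix_word_length by (meson not_le)
  have strict: "\<not> subprefix x z" if "strict_subprefix z x" for x z
    using that long by (simp add: strict_subprefix_def)
  show ?thesis
    apply (intro conjI allI impI)
           apply (rule sectional_curvature_a_hat)
          apply (rule finite_common_subprefixes)
         apply (simp only: infsum_int_prod_sq[OF long] infsum_int_sq_mult)
        apply (erule int_sq_eq_0)
       apply (simp only: neg_le_0_iff_le)
       apply (elim conjE)
       apply (erule (1) int_sq_mult_nonneg)
      apply (rule int_sq_eq_0, erule strict)
     apply (erule finite_int_prod_neq_0)
    apply (rule finite_int_sq_mult_neq_0)
    done
qed

end
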